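(* Let $P=([n],\preceq)$ be a chain, $w$ a weight on $\mathbb{F}_q$, $\pi(i)=k_i$ a label map with $N=\sum_ik_i$, and $x\in\mathbb{F}_q^N$. If $r=tM_w+s$ with $s\in\{1,2,\dots,M_w\}$ and $t\ge0$, then $B_{(P,w,\pi)}(x,r)\subseteq B_{(P,\pi)}(x,t+1)$. Furthermore, $B_{(P,w,\pi)}(x,r)=B_{(P,\pi)}(x,t+1)$ if and only if $r$ is a multiple of $M_w$.
   Context: A weight on $\mathbb{F}_q$ is a map $w:\mathbb{F}_q\to\mathbb{N}\cup\{0\}$ with $w(\alpha)=0$ iff $\alpha=0$, $w(-\alpha)=w(\alpha)$, $w(\alpha+\beta)\le w(\alpha)+w(\beta)$; $M_w=\max_\alpha w(\alpha)$; $\tilde w^k(v)=\max_s w(v_s)$. Ideals of $P$ are down-closed subsets; $\langle A\rangle$ is the generated ideal. For $y=y_1\oplus\cdots\oplus y_n\in\mathbb{F}_q^{k_1}\oplus\cdots\oplus\mathbb{F}_q^{k_n}$, $supp_\pi(y)=\{i:y_i\ne0\}$, $I_y=\langle supp_\pi(y)\rangle$, $M_y$ its maximal elements, $w_{(P,w,\pi)}(y)=\sum_{i\in M_y}\tilde w^{k_i}(y_i)+|I_y\setminus M_y|\,M_w$ and $w_{(P,\pi)}(y)=|I_y|$. $B_{(P,w,\pi)}(x,r)=\{y:w_{(P,w,\pi)}(x-y)\le r\}$ and $B_{(P,\pi)}(x,m)=\{y:w_{(P,\pi)}(x-y)\le m\}$.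
   Formalization: The "only if" half of the equivalence is proved for t < n only; for t ≥ n both balls are all of F_q^N, so it fails (e.g. n = 1, k_1 = 1, q = 5, Lee weight, r = 3). The inclusion and the "if" half hold for all t. Labels k_i are positive. *)

theory Defs
  imports Complex_Main "Jordan_Normal_Form.Matrix"
begin

definition is_weight :: "('a::field \<Rightarrow> nat) \<Rightarrow> bool" where
  "is_weight w \<longleftrightarrow>
     (\<forall>a. w a = 0 \<longleftrightarrow> a = 0) \<and> (\<forall>a. w (- a) = w a) \<and> (\<forall>a b. w (a + b) \<le> w a + w b)"

definition max_weight :: "('a::{field,finite} \<Rightarrow> nat) \<Rightarrow> nat" where
  "max_weight w = Max (range w)"

text \<open>Only meaningful for vectors of positive dimension.\<close>
definition max_coord_weight :: "('a::field \<Rightarrow> nat) \<Rightarrow> 'a vec \<Rightarrow> nat" where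
  "max_coord_weight w v = Max ((\<lambda>s. w (v $ s)) ` {..<dim_vec v})"

text \<open>A poset on \<open>[n] = {1..n}\<close> is a relation \<open>P\<close> with \<open>partial_order_on {1..n} P\<close>,
  where \<open>(i, j) \<in> P\<close> means that \<open>i\<close> is below or equal to \<open>j\<close>.\<close>
definition is_ideal :: "nat \<Rightarrow> nat rel \<Rightarrow> nat set \<Rightarrow> bool" where
  "is_ideal n P I \<longleftrightarrow> I \<subseteq> {1..n} \<and> (\<forall>i\<in>I. \<forall>j. (j, i) \<in> P \<longrightarrow> j \<in> I)"

definition maximal_elems :: "nat rel \<Rightarrow> nat set \<Rightarrow> nat set" where
  "maximal_elems P I = {i \<in> I. \<forall>j\<in>I. (i, j) \<in> P \<longrightarrow> j = i}"

text \<open>\<open>F^N\<close> with \<open>N = k 1 + \<dots> + k n\<close> is \<open>carrier_vec N\<close>, with coordinates \<open>0, \<dots>, N - 1\<close>. Its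
  identification with the direct sum of the \<open>F^(k i)\<close> cuts a vector into consecutive pieces.\<close>
definition block :: "(nat \<Rightarrow> nat) \<Rightarrow> 'a vec \<Rightarrow> nat \<Rightarrow> 'a vec" where
  "block k y i = vec (k i) (\<lambda>s. y $ ((\<Sum>j = 1..<i. k j) + s))"

definition block_supp :: "nat \<Rightarrow> (nat \<Rightarrow> nat) \<Rightarrow> 'a::field vec \<Rightarrow> nat set" where
  "block_supp n k y = {i \<in> {1..n}. block k y i \<noteq> 0\<^sub>v (k i)}"

definition supp_ideal :: "nat \<Rightarrow> nat rel \<Rightarrow> (nat \<Rightarrow> nat) \<Rightarrow> 'a::field vec \<Rightarrow> nat set" where
  "supp_ideal n P k y = is_ideal n P hull block_supp n k y"

definition Pw_pi_weight ::
  "nat \<Rightarrow> nat rel \<Rightarrow> ('a::{field,finite} \<Rightarrow> nat) \<Rightarrow> (nat \<Rightarrow> nat) \<Rightarrow> 'a vec \<Rightarrow> nat" where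
  "Pw_pi_weight n P w k y =
     (let I = supp_ideal n P k y; M = maximal_elems P I
      in (\<Sum>i\<in>M. max_coord_weight w (block k y i)) + card (I - M) * max_weight w)"

definition P_pi_weight :: "nat \<Rightarrow> nat rel \<Rightarrow> (nat \<Rightarrow> nat) \<Rightarrow> 'a::field vec \<Rightarrow> nat" where
  "P_pi_weight n P k y = card (supp_ideal n P k y)"

definition Pw_pi_ball ::
  "nat \<Rightarrow> nat rel \<Rightarrow> ('a::{field,finite} \<Rightarrow> nat) \<Rightarrow> (nat \<Rightarrow> nat) \<Rightarrow> 'a vec \<Rightarrow> nat \<Rightarrow> 'a vec set" where
  "Pw_pi_ball n P w k x r =
     {y \<in> carrier_vec (\<Sum>i = 1..n. k i). Pw_pi_weight n P w k (x - y) \<le> r}"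

definition P_pi_ball ::
  "nat \<Rightarrow> nat rel \<Rightarrow> (nat \<Rightarrow> nat) \<Rightarrow> 'a::field vec \<Rightarrow> nat \<Rightarrow> 'a vec set" where
  "P_pi_ball n P k x m =
     {y \<in> carrier_vec (\<Sum>i = 1..n. k i). P_pi_weight n P k (x - y) \<le> m}"

end

(* Over a chain the ideal of a nonzero y has a single maximal element m, so y has weight c + d M_w,
   where 1 <= c <= M_w comes from the block at m and d + 1 is the size of the ideal. Hence weight
   at most t M_w + s forces d <= t. If s < M_w and t < n, the ball of radius r misses a vector
   supported in the block at the (t+1)-st element of the chain with a coordinate of weight M_w. *)
theory Submission
  imports Defs
begin

section \<open>Finite chains\<close>

lemma linear_order_onD:
  assumes "linear_order_on A P"
  shows "P \<subseteq> A \<times> A" "\<And>a. a \<in> A \<Longrightarrow> (a, a) \<in> P"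
    "\<And>a b c. (a, b) \<in> P \<Longrightarrow> (b, c) \<in> P \<Longrightarrow> (a, c) \<in> P"
    "\<And>a b. (a, b) \<in> P \<Longrightarrow> (b, a) \<in> P \<Longrightarrow> a = b"
    "\<And>a b. a \<in> A \<Longrightarrow> b \<in> A \<Longrightarrow> (a, b) \<in> P \<or> (b, a) \<in> P"
  using assms
  unfolding linear_order_on_def partial_order_on_def preorder_on_def refl_on_def total_on_def
  by (simp, simp, blast dest: transD, blast dest: antisymD, metis)

text \<open>Supplies the top element of a block support, which by itself generates the ideal when
  the order is a chain.\<close>

lemma linear_order_on_has_greatest:
  assumes lin: "linear_order_on A P" and "finite S" "S \<noteq> {}" "S \<subseteq> A"
  shows "\<exists>m\<in>S. \<forall>i\<in>S. (i, m) \<in> P"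
  using assms(2-)
proof (induction S rule: finite_ne_induct)
  case (singleton a)
  then show ?case using linear_order_onD(2)[OF lin] by auto
next
  case (insert a S)
  then obtain m where m: "m \<in> S" "\<forall>i\<in>S. (i, m) \<in> P" by auto
  consider "(a, m) \<in> P" | "(m, a) \<in> P"
    using linear_order_onD(5)[OF lin] insert.prems m(1) by blast
  then show ?case
  proof cases
    case 1
    then show ?thesis using m by blast
  next
    case 2
    then show ?thesis
      using m linear_order_onD(2,3)[OF lin] insert.prems by (metis insert_iff insert_subset)
  qed
qed

text \<open>The size of the down-set is a strictly increasing rank on the chain, hence an injective
  map from \<open>{1..n}\<close> to itself. On a finite set such a map is onto, so the rank
  \<open>t + 1\<close> is attained.\<close>

lemma linear_order_on_ex_card_down_set:
  assumes lin: "linear_order_on {1..n} P" and "t < n"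
  shows "\<exists>m\<in>{1..n}. card {j. (j, m) \<in> P} = t + 1"
proof -
  note P = linear_order_onD[OF lin]
  define rk where "rk m = card {j. (j, m) \<in> P}" for m
  have sub: "{j. (j, m) \<in> P} \<subseteq> {1..n}" for m using P(1) by auto
  have fin: "finite {j. (j, m) \<in> P}" for m using sub finite_subset by blast
  have less: "rk a < rk b" if "(a, b) \<in> P" "a \<noteq> b" for a b
  proof -
    have "b \<in> {1..n}" using P(1) that by auto
    \<comment> \<open>Strictness is witnessed by \<open>b\<close> itself: antisymmetry keeps it out
      of the down-set of \<open>a\<close>.\<close>
    hence "b \<in> {j. (j, b) \<in> P} - {j. (j, a) \<in> P}"
      using P(2,4) that by blast
    moreover have "{j. (j, a) \<in> P} \<subseteq> {j. (j, b) \<in> P}"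
      using P(3) that by blast
    ultimately have "{j. (j, a) \<in> P} \<subset> {j. (j, b) \<in> P}" by blast
    thus ?thesis unfolding rk_def using fin psubset_card_mono by blast
  qed
  have "rk m \<in> {1..n}" if "m \<in> {1..n}" for m
  proof -
    have "card {m} \<le> rk m"
      unfolding rk_def using P(2) that by (intro card_mono fin) auto
    moreover have "rk m \<le> card {1..n}"
      unfolding rk_def by (intro card_mono sub) auto
    ultimately show ?thesis by simp
  qed
  hence img: "rk ` {1..n} \<subseteq> {1..n}" by blast
  have "inj_on rk {1..n}"
    using less P(5) by (metis inj_onI less_irrefl)
  hence "rk ` {1..n} = {1..n}" using img by (intro endo_inj_surj) auto
  moreover have "t + 1 \<in> {1..n}" using \<open>t < n\<close> by auto
  ultimately have "t + 1 \<in> rk ` {1..n}" by simp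
  thus ?thesis unfolding rk_def by auto
qed

section \<open>Support ideals and the two weights over a chain\<close>

lemma block_supp_subset: "block_supp n k y \<subseteq> {1..n}"
  by (auto simp: block_supp_def)

lemma finite_block_supp: "finite (block_supp n k y)"
  by (rule finite_subset[OF block_supp_subset]) simp

lemma supp_ideal_empty:
  assumes "block_supp n k y = {}"
  shows "supp_ideal n P k y = {}"
  using assms by (auto simp: supp_ideal_def hull_def is_ideal_def)

text \<open>The down-set of \<open>m\<close> is an ideal by transitivity, and down-closure forces it
  into every ideal that contains \<open>m\<close>.\<close>

lemma supp_ideal_down_set:
  assumes lin: "linear_order_on {1..n} P"
    and m: "m \<in> block_supp n k y" "\<And>i. i \<in> block_supp n k y \<Longrightarrow> (i, m) \<in> P"
  shows "supp_ideal n P k y = {j. (j, m) \<in> P}"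
  unfolding supp_ideal_def
proof (rule hull_unique)
  note P = linear_order_onD[OF lin]
  show "is_ideal n P {j. (j, m) \<in> P}"
    using P(1,3) unfolding is_ideal_def by blast
  show "block_supp n k y \<subseteq> {j. (j, m) \<in> P}" using m(2) by blast
  show "{j. (j, m) \<in> P} \<subseteq> I" if "block_supp n k y \<subseteq> I" "is_ideal n P I" for I
    using that m(1) unfolding is_ideal_def by blast
qed

text \<open>By antisymmetry \<open>m\<close> is the only maximal element of its down-set, so one
  block counts with its own weight and every other element counts \<open>max_weight w\<close>. The
  bound \<open>\<ge> 1\<close> makes the truncated subtraction exact.\<close>

lemma weights_chain:
  fixes w :: "'a::{field,finite} \<Rightarrow> nat"
  assumes lin: "linear_order_on {1..n} P"
    and m: "m \<in> block_supp n k y" "\<And>i. i \<in> block_supp n k y \<Longrightarrow> (i, m) \<in> P"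
  shows "P_pi_weight n P k y = card {j. (j, m) \<in> P}"
    and "Pw_pi_weight n P w k y =
      max_coord_weight w (block k y m) + (card {j. (j, m) \<in> P} - 1) * max_weight w"
    and "card {j. (j, m) \<in> P} \<ge> 1"
proof -
  note P = linear_order_onD[OF lin]
  have mn: "m \<in> {1..n}" using m(1) by (auto simp: block_supp_def)
  let ?D = "{j. (j, m) \<in> P}"
  have fin: "finite ?D" by (rule finite_subset[of _ "{1..n}"]) (use P(1) in auto)
  have mD: "m \<in> ?D" using P(2) mn by auto
  have max: "maximal_elems P ?D = {m}"
    using mD P(4) unfolding maximal_elems_def by blast
  show "P_pi_weight n P k y = card ?D"
    by (simp add: P_pi_weight_def supp_ideal_down_set[OF lin m])
  show "Pw_pi_weight n P w k y =
      max_coord_weight w (block k y m) + (card ?D - 1) * max_weight w"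
    using mD fin
    by (simp add: Pw_pi_weight_def supp_ideal_down_set[OF lin m] max card_Diff_singleton)
  show "card ?D \<ge> 1" using mD fin by (metis One_nat_def Suc_leI card_gt_0_iff empty_iff)
qed

lemma max_weight_ge:
  fixes w :: "'a::{field,finite} \<Rightarrow> nat"
  shows "w a \<le> max_weight w"
  unfolding max_weight_def by (intro Max_ge) auto

lemma max_weight_attained:
  fixes w :: "'a::{field,finite} \<Rightarrow> nat"
  obtains a where "w a = max_weight w"
proof -
  have "max_weight w \<in> range w" unfolding max_weight_def by (intro Max_in) auto
  thus ?thesis using that by auto
qed

lemma coord_weight_le_max: "i < dim_vec v \<Longrightarrow> w (v $ i) \<le> max_coord_weight w v"
  unfolding max_coord_weight_def by (intro Max_ge) auto

lemma max_coord_weight_le: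
  fixes w :: "'a::{field,finite} \<Rightarrow> nat"
  assumes "dim_vec v > 0"
  shows "max_coord_weight w v \<le> max_weight w"
  unfolding max_coord_weight_def
  by (subst Max_le_iff) (use assms max_weight_ge in auto)

lemma max_coord_weight_pos:
  assumes "is_weight w" "v \<in> carrier_vec d" "v \<noteq> 0\<^sub>v d"
  shows "max_coord_weight w v > 0"
proof -
  obtain i where i: "i < d" "v $ i \<noteq> 0" using assms(2,3) by (metis carrier_vecD eq_vecI index_zero_vec)
  hence "w (v $ i) > 0" using assms(1) by (auto simp: is_weight_def)
  thus ?thesis using coord_weight_le_max[of i v w] i assms(2) by auto
qed

text \<open>A division with remainder in \<open>{1..max_weight w}\<close>, the same shape as
  \<open>r = t * max_weight w + s\<close>, so that weights and radius can be compared by quotient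
  first. The zero vector is split off because its weight admits no positive
  \<open>c\<close>.\<close>

lemma weights_chain_cases:
  fixes w :: "'a::{field,finite} \<Rightarrow> nat"
  assumes lin: "linear_order_on {1..n} P" and w: "is_weight w"
  obtains (zero) "P_pi_weight n P k y = 0" "Pw_pi_weight n P w k y = 0"
  | (nonzero) c d where "P_pi_weight n P k y = d + 1"
      "Pw_pi_weight n P w k y = c + d * max_weight w" "0 < c" "c \<le> max_weight w"
proof (cases "block_supp n k y = {}")
  case True
  show ?thesis
    by (rule zero)
      (simp_all add: P_pi_weight_def Pw_pi_weight_def supp_ideal_empty[OF True] maximal_elems_def)
next
  case False
  obtain m where m: "m \<in> block_supp n k y" "\<And>i. i \<in> block_supp n k y \<Longrightarrow> (i, m) \<in> P"
    using linear_order_on_has_greatest[OF lin finite_block_supp False block_supp_subset] by blast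
  have nz: "block k y m \<noteq> 0\<^sub>v (k m)" and car: "block k y m \<in> carrier_vec (k m)"
    using m(1) by (auto simp: block_supp_def block_def)
  \<comment> \<open>A block of length 0 would equal the zero vector. Positive length means that the
    maximum of the coordinate weights runs over a nonempty set.\<close>
  have "k m \<noteq> 0" using nz car by (intro notI) auto
  hence "max_coord_weight w (block k y m) \<le> max_weight w"
    using car by (intro max_coord_weight_le) auto
  thus ?thesis
    using weights_chain[OF lin m] max_coord_weight_pos[OF w car nz]
    by (intro nonzero[of "card {j. (j, m) \<in> P} - 1"]) auto
qed

section \<open>Vectors supported in a single block\<close>

lemma block_position_eq:
  fixes k :: "nat \<Rightarrow> nat"
  assumes "(\<Sum>j = 1..<i. k j) + a = (\<Sum>j = 1..<m. k j) + b" "a < k i" "b < k m" "1 \<le> i" "1 \<le> m"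
  shows "i = m"
proof -
  \<comment> \<open>Block \<open>i\<close> ends no later than block \<open>m\<close> starts, so a
    shared coordinate rules out both \<open>i < m\<close> and \<open>m < i\<close>.\<close>
  have step: "(\<Sum>j = 1..<i. k j) + k i \<le> (\<Sum>j = 1..<m. k j)" if "i < m" "1 \<le> i" for i m :: nat
  proof -
    have "(\<Sum>j = 1..<i. k j) + k i = (\<Sum>j = 1..<Suc i. k j)" using that by simp
    also have "\<dots> \<le> (\<Sum>j = 1..<m. k j)" using that by (intro sum_mono2) auto
    finally show ?thesis .
  qed
  show ?thesis
    using step[of i m] step[of m i] assms by (cases i m rule: linorder_cases) auto
qed

lemma ex_vec_in_block:
  fixes a :: "'a::field"
  assumes pos: "k m \<ge> 1" and m: "m \<in> {1..n}" and "a \<noteq> 0"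
  obtains z where "z \<in> carrier_vec (\<Sum>i = 1..n. k i)" "block_supp n k z = {m}" "block k z m $ 0 = a"
proof
  \<comment> \<open>The single nonzero coordinate is the first one of block
    \<open>m\<close>.\<close>
  define z where
    "z = vec (\<Sum>i = 1..n. k i) (\<lambda>j. if j = (\<Sum>j = 1..<m. k j) then a else 0)"
  \<comment> \<open>Every coordinate of every block is a legal index of \<open>z\<close>, so
    \<open>$\<close> evaluates to the defining function.\<close>
  have lt: "(\<Sum>j = 1..<i. k j) + s < (\<Sum>i = 1..n. k i)" if "i \<in> {1..n}" "s < k i" for i s
  proof -
    have "(\<Sum>j = 1..<i. k j) + k i = (\<Sum>j = 1..<Suc i. k j)" using that by simp
    also have "\<dots> \<le> (\<Sum>i = 1..n. k i)" using that by (intro sum_mono2) auto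
    finally show ?thesis using that by simp
  qed
  show "z \<in> carrier_vec (\<Sum>i = 1..n. k i)" by (simp add: z_def)
  show a: "block k z m $ 0 = a"
    using lt[OF m, of 0] pos by (simp add: block_def z_def)
  have "block k z i = 0\<^sub>v (k i)" if i: "i \<in> {1..n}" "i \<noteq> m" for i
  proof (rule eq_vecI)
    fix s assume "s < dim_vec (0\<^sub>v (k i))"
    hence s: "s < k i" by simp
    have "(\<Sum>j = 1..<i. k j) + s \<noteq> (\<Sum>j = 1..<m. k j)"
      using block_position_eq[where k = k and a = s and b = 0 and i = i and m = m] s pos m i by auto
    thus "block k z i $ s = 0\<^sub>v (k i) $ s"
      using s lt[OF i(1) s] by (simp add: block_def z_def)
  qed (simp add: block_def)
  moreover have "block k z m \<noteq> 0\<^sub>v (k m)" using a \<open>a \<noteq> 0\<close> pos by auto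
  ultimately show "block_supp n k z = {m}" using m by (auto simp: block_supp_def)
qed

text \<open>Realises the largest weight possible with an ideal of size \<open>t + 1\<close>: the top
  block carries a coordinate of weight \<open>max_weight w\<close>. This is the vector that
  separates the two balls when \<open>s < max_weight w\<close>.\<close>

lemma ex_vec_extremal_weight:
  fixes w :: "'a::{field,finite} \<Rightarrow> nat"
  assumes lin: "linear_order_on {1..n} P" and w: "is_weight w"
    and k: "\<And>i. i \<in> {1..n} \<Longrightarrow> k i \<ge> 1" and "t < n" and "max_weight w > 0"
  obtains z where "z \<in> carrier_vec (\<Sum>i = 1..n. k i)"
    "P_pi_weight n P k z = t + 1" "Pw_pi_weight n P w k z = (t + 1) * max_weight w"
proof -
  obtain m where m: "m \<in> {1..n}" "card {j. (j, m) \<in> P} = t + 1"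
    using linear_order_on_ex_card_down_set[OF lin \<open>t < n\<close>] by blast
  obtain a where a: "w a = max_weight w" by (rule max_weight_attained)
  have "w 0 = 0" using w by (simp add: is_weight_def)
  hence "a \<noteq> 0" using a \<open>max_weight w > 0\<close> by auto
  then obtain z where z: "z \<in> carrier_vec (\<Sum>i = 1..n. k i)" "block_supp n k z = {m}"
    "block k z m $ 0 = a"
    using ex_vec_in_block[where k = k and m = m, OF k[OF m(1)] m(1)] by metis
  have dim: "dim_vec (block k z m) > 0" using k[OF m(1)] by (simp add: block_def)
  \<comment> \<open>Squeezed between the weight of coordinate 0 and the global maximum.\<close>
  have top: "max_coord_weight w (block k z m) = max_weight w"
    using coord_weight_le_max[OF dim, of w] max_coord_weight_le[OF dim, of w] z(3) a by simp
  have "m \<in> block_supp n k z" "\<And>i. i \<in> block_supp n k z \<Longrightarrow> (i, m) \<in> P"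
    using z(2) m(1) linear_order_onD(2)[OF lin] by auto
  note wt = weights_chain[OF lin this]
  show ?thesis using wt(1) wt(2)[of w] m(2) top by (intro that[OF z(1)]) auto
qed

section \<open>Comparison of the balls\<close>

theorem theorem5p2:
  fixes n N r s t :: nat
    and P :: "nat rel"
    and w :: "'a::{field,finite} \<Rightarrow> nat"
    and k :: "nat \<Rightarrow> nat"
    and x :: "'a vec"
  assumes "linear_order_on {1..n} P"
    and "is_weight w"
    and "\<And>i. i \<in> {1..n} \<Longrightarrow> k i \<ge> 1"
    and "N = (\<Sum>i = 1..n. k i)"
    and "x \<in> carrier_vec N"
    and "r = t * max_weight w + s"
    and "s \<in> {1..max_weight w}"
  shows "Pw_pi_ball n P w k x r \<subseteq> P_pi_ball n P k x (t + 1) \<and>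
    (max_weight w dvd r \<longrightarrow> Pw_pi_ball n P w k x r = P_pi_ball n P k x (t + 1)) \<and>
    (t < n \<longrightarrow>
       (Pw_pi_ball n P w k x r = P_pi_ball n P k x (t + 1) \<longleftrightarrow> max_weight w dvd r))"
proof -
  let ?M = "max_weight w"
  note lin = assms(1) and w = assms(2) and k = assms(3) and r = assms(6)
  have s: "0 < s" "s \<le> ?M" using assms(7) by auto
  have sub: "Pw_pi_ball n P w k x r \<subseteq> P_pi_ball n P k x (t + 1)"
  proof -
    have "P_pi_weight n P k y \<le> t + 1" if "Pw_pi_weight n P w k y \<le> r" for y
      using lin w
    proof (cases rule: weights_chain_cases[where k = k and y = y])
      case (nonzero c d)
      \<comment> \<open>Since \<open>0 < c\<close> and \<open>s \<le> ?M\<close>, we get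
        \<open>d * ?M < c + d * ?M \<le> t * ?M + s \<le> (t + 1) * ?M\<close>; the strict
        inequality is what excludes \<open>d = t + 1\<close>.\<close>
      have "d * ?M < (t + 1) * ?M" using that nonzero r s by simp
      hence "d < t + 1" by (metis mult_less_cancel2)
      thus ?thesis using nonzero by simp
    qed simp
    thus ?thesis by (auto simp: Pw_pi_ball_def P_pi_ball_def)
  qed
  have eq: "Pw_pi_ball n P w k x r = P_pi_ball n P k x (t + 1)" if "?M dvd r"
  proof -
    have "?M dvd s" using that r by (metis dvd_add_right_iff dvd_triv_right)
    \<comment> \<open>Here the remainder range \<open>{1..?M}\<close> matters: its only multiple of
      \<open>?M\<close> is \<open>?M\<close> itself, so \<open>r\<close> is the full
      \<open>(t + 1) * ?M\<close>.\<close>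
    hence "s = ?M" using s by (meson dvd_imp_le le_antisym)
    hence r': "r = (t + 1) * ?M" using r by simp
    have "Pw_pi_weight n P w k y \<le> r" if "P_pi_weight n P k y \<le> t + 1" for y
      using lin w
    proof (cases rule: weights_chain_cases[where k = k and y = y])
      case (nonzero c d)
      have "d * ?M \<le> t * ?M" using that nonzero by (intro mult_right_mono) auto
      with nonzero(4) have "c + d * ?M \<le> ?M + t * ?M" by (rule add_mono)
      thus ?thesis unfolding nonzero(2) r' by simp
    qed simp
    thus ?thesis using sub by (auto simp: Pw_pi_ball_def P_pi_ball_def)
  qed
  \<comment> \<open>The restriction \<open>t < n\<close> is essential to the converse: for
    \<open>t \<ge> n\<close> all weights are at most \<open>n * ?M < r\<close> and all ideals have
    size at most \<open>n\<close>, so both balls are the whole space whatever \<open>s\<close>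
    is.\<close>
  have "?M dvd r"
    if "t < n" and balls: "Pw_pi_ball n P w k x r = P_pi_ball n P k x (t + 1)"
  proof -
    have "?M > 0" using s by simp
    then obtain z where z: "z \<in> carrier_vec (\<Sum>i = 1..n. k i)"
      "P_pi_weight n P k z = t + 1" "Pw_pi_weight n P w k z = (t + 1) * ?M"
      using ex_vec_extremal_weight[where k = k, OF lin w k \<open>t < n\<close>] by blast
    have x: "x \<in> carrier_vec (\<Sum>i = 1..n. k i)" using assms(4,5) by simp
    \<comment> \<open>The balls measure \<open>x - y\<close>, so the point \<open>y = x - z\<close>
      is tested through the weights of \<open>z\<close>.\<close>
    have xz: "x - (x - z) = z" by (rule eq_vecI) (use x z(1) in auto)
    have "x - z \<in> P_pi_ball n P k x (t + 1)"
      using z(1,2) x xz by (auto simp: P_pi_ball_def)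
    hence "(t + 1) * ?M \<le> r"
      using z(3) xz unfolding balls[symmetric] by (auto simp: Pw_pi_ball_def)
    \<comment> \<open>The reverse inequality is \<open>s \<le> ?M\<close>.\<close>
    hence "r = (t + 1) * ?M" using r s by simp
    thus ?thesis by simp
  qed
  with sub eq show ?thesis by blast
qed

end
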